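(* There exists an absolute constant $K>0$ such that for every integer $d\geq 1$, every almost-equidistant set $V\subset\mathbb{R}^d$ is finite and satisfies $|V|\leq K d^{4/3}$. That is, an almost-equidistant set in $\mathbb{R}^d$ has cardinality $O(d^{4/3})$.
   Context: $\mathbb{R}^d$ is $d$-dimensional Euclidean space with the Euclidean norm $\|\cdot\|$. A subset $V\subseteq\mathbb{R}^d$ is called almost equidistant if among any three distinct points of $V$, some two are at Euclidean distance exactly $1$. *)

theory Defs
  imports "HOL-Analysis.Analysis"
begin

text \<open>
  The constant of the theorem is chosen before the dimension, so the dimension has to be a
  term rather than a type: $d$-dimensional space is the carrier of the library's
  \<^const>\<open>Euclidean_space\<close>, that is, the functions on the naturals that vanish
  at all indices from \<open>d\<close> on.
\<close>

definition euclidean_dist :: "nat \<Rightarrow> (nat \<Rightarrow> real) \<Rightarrow> (nat \<Rightarrow> real) \<Rightarrow> real" where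
  "euclidean_dist d x y = L2_set (\<lambda>i. x i - y i) {..<d}"

definition almost_equidistant :: "nat \<Rightarrow> (nat \<Rightarrow> real) set \<Rightarrow> bool" where
  "almost_equidistant d V \<longleftrightarrow>
     V \<subseteq> topspace (Euclidean_space d) \<and>
     (\<forall>x\<in>V. \<forall>y\<in>V. \<forall>z\<in>V. x \<noteq> y \<and> x \<noteq> z \<and> y \<noteq> z \<longrightarrow>
        euclidean_dist d x y = 1 \<or> euclidean_dist d x z = 1 \<or> euclidean_dist d y z = 1)"

end

theory Submission
  imports Defs
begin

text \<open>
  Translate the \<open>n\<close> points so that their centroid is the origin. Let \<open>A\<close> be twice the
  Gram matrix and let \<open>U\<close> be the matrix of squared distances minus 1, with zero diagonal. Then
  \<open>A = I - U + q 1\<^sup>T + 1 q\<^sup>T\<close> and \<open>A 1 = 0\<close>, and \<open>tr U\<^sup>3 = 0\<close>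
  because the graph of pairs at distance other than 1 is triangle-free. As \<open>A\<close> is positive
  semidefinite of rank at most \<open>d\<close>, \<open>(tr A)\<^sup>3 \<le> d\<^sup>2 tr A\<^sup>3\<close>. Expanding
  \<open>tr A\<^sup>3\<close> bounds it by \<open>O(n R + R\<^sup>3 + n)\<close>, where \<open>R\<close> is the largest absolute row sum
  of \<open>U\<close>, while \<open>tr A\<close> is about \<open>n\<close>.

  To bound \<open>R\<close>, note that the points not at distance 1 from a given one form a unit simplex, so
  there are at most \<open>d + 1\<close> of them and they are nearly orthogonal about the centroid, up to an
  error \<open>O(R/n)\<close> in the inner products. Cauchy--Schwarz then gives
  \<open>R = O(\<surd>d + d\<^sup>2/n)\<close>, which is \<open>O(d\<^bsup>2/3\<^esup>)\<close> once \<open>n\<close> is at least of order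
  \<open>d\<^bsup>4/3\<^esup>\<close>, and the trace inequality fails for \<open>n \<ge> 40 d\<^bsup>4/3\<^esup>\<close>.
\<close>

section \<open>Matrices attached to a centred configuration\<close>

locale centered_config =
  fixes V :: "'a set" and d :: nat and f :: "'a \<Rightarrow> nat \<Rightarrow> real"
  assumes fin: "finite V" and nonempty: "V \<noteq> {}"
    and centered: "i < d \<Longrightarrow> (\<Sum>x\<in>V. f x i) = 0"
begin

definition A :: "'a \<Rightarrow> 'a \<Rightarrow> real" where
  "A x y = 2 * (\<Sum>i<d. f x i * f y i)"

text \<open>The excess of the squared distance to the centroid over 1/2, the limit of the squared
  circumradius of a large unit simplex.\<close>

definition q :: "'a \<Rightarrow> real" where
  "q x = (A x x - 1) / 2"

text \<open>The diagonal is set separately because the formula would give -1 there. Thus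
  \<open>U\<close> vanishes exactly on equal points and on pairs at distance 1.\<close>

definition U :: "'a \<Rightarrow> 'a \<Rightarrow> real" where
  "U x y = (if x = y then 0 else (\<Sum>i<d. (f x i - f y i)\<^sup>2) - 1)"

definition r :: "'a \<Rightarrow> real" where
  "r x = (\<Sum>y\<in>V. U x y)"

text \<open>The traces of \<open>A\<close>, its square and its cube, and of the square of
  \<open>U\<close>, written as entry sums by symmetry so that no matrix type or eigenvalue is
  involved.\<close>

definition tr1 :: real where "tr1 = (\<Sum>x\<in>V. A x x)"
definition tr2 :: real where "tr2 = (\<Sum>x\<in>V. \<Sum>y\<in>V. A x y * A x y)"
definition tr3 :: real where "tr3 = (\<Sum>x\<in>V. \<Sum>z\<in>V. (\<Sum>y\<in>V. A x y * A y z) * A x z)"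
definition trU2 :: real where "trU2 = (\<Sum>x\<in>V. \<Sum>y\<in>V. U x y * U x y)"

abbreviation n :: real where "n \<equiv> real (card V)"

lemma n_pos: "n > 0"
  using fin nonempty by (simp add: card_gt_0_iff)

lemma A_sym: "A x y = A y x"
  by (simp add: A_def mult.commute)

lemma U_sym: "U x y = U y x"
  by (simp add: U_def power2_commute)

lemma U_diag [simp]: "U x x = 0"
  by (simp add: U_def)

lemma A_eq: "A x y = of_bool (x = y) - U x y + q x + q y"
proof (cases "x = y")
  case False
  have "(\<Sum>i<d. (f x i - f y i)\<^sup>2) = (\<Sum>i<d. f x i * f x i + f y i * f y i - 2 * (f x i * f y i))"
    by (rule sum.cong) (auto simp: power2_eq_square algebra_simps)
  then show ?thesis using False
    by (simp add: A_def U_def q_def sum.distrib sum_subtractf sum_distrib_left[symmetric] field_simps)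
qed (simp add: q_def)

lemma A_row_sum: "(\<Sum>y\<in>V. A x y) = 0"
proof -
  have "(\<Sum>y\<in>V. A x y) = 2 * (\<Sum>i<d. f x i * (\<Sum>y\<in>V. f y i))"
    unfolding A_def sum_distrib_left by (rule sum.swap)
  then show ?thesis by (simp add: centered)
qed

lemma A_col_sum: "(\<Sum>x\<in>V. A x y) = 0"
  using A_row_sum[of y] by (simp add: A_sym)

text \<open>Substitutes \<open>A_eq\<close> for one factor \<open>A\<close> in the trace pairing
  with an arbitrary \<open>F\<close>. The \<open>q\<close> terms see only row and column sums of
  \<open>F\<close>, so they vanish when \<open>F\<close> has zero sums.\<close>

lemma A_contract:
  "(\<Sum>x\<in>V. \<Sum>y\<in>V. F x y * A x y) = (\<Sum>x\<in>V. F x x) - (\<Sum>x\<in>V. \<Sum>y\<in>V. F x y * U x y)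
     + (\<Sum>x\<in>V. q x * (\<Sum>y\<in>V. F x y)) + (\<Sum>y\<in>V. q y * (\<Sum>x\<in>V. F x y))"
proof -
  have "(\<Sum>x\<in>V. \<Sum>y\<in>V. F x y * A x y) =
      (\<Sum>x\<in>V. \<Sum>y\<in>V. F x y * of_bool (x = y)) - (\<Sum>x\<in>V. \<Sum>y\<in>V. F x y * U x y)
     + (\<Sum>x\<in>V. \<Sum>y\<in>V. q x * F x y) + (\<Sum>x\<in>V. \<Sum>y\<in>V. q y * F x y)"
    unfolding A_eq by (simp add: algebra_simps sum.distrib sum_subtractf)
  moreover have "(\<Sum>x\<in>V. \<Sum>y\<in>V. F x y * of_bool (x = y)) = (\<Sum>x\<in>V. F x x)"
    using fin by (intro sum.cong refl) (simp add: of_bool_def if_distrib cong: if_cong)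
  moreover have "(\<Sum>x\<in>V. \<Sum>y\<in>V. q y * F x y) = (\<Sum>y\<in>V. \<Sum>x\<in>V. q y * F x y)"
    by (rule sum.swap)
  ultimately show ?thesis by (simp add: sum_distrib_left)
qed

text \<open>A zero row sum of \<open>A\<close> gives \<open>n * q x = r x - 1 - sum q\<close>.
  Summing this over all points determines the sum of \<open>q\<close>, which is then substituted
  back.\<close>

lemma n_times_q: "n * q x = r x - 1 / 2 - (\<Sum>y\<in>V. r y) / (2 * n)" if "x \<in> V"
proof -
  have row: "n * q x = r x - 1 - (\<Sum>y\<in>V. q y)" if "x \<in> V" for x
  proof -
    have "(\<Sum>y\<in>V. of_bool (x = y)) = (1::real)"
      using fin that by (simp add: of_bool_def)
    then show ?thesis
      using A_row_sum[of x] by (simp add: A_eq sum.distrib sum_subtractf r_def)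
  qed
  have "n * (\<Sum>y\<in>V. q y) = (\<Sum>y\<in>V. r y - 1 - (\<Sum>y\<in>V. q y))"
    unfolding sum_distrib_left by (rule sum.cong) (auto simp: row)
  then have "n * (\<Sum>y\<in>V. q y) = (\<Sum>y\<in>V. r y) - n - n * (\<Sum>y\<in>V. q y)"
    by (simp add: sum_subtractf)
  then have "(\<Sum>y\<in>V. q y) = (\<Sum>y\<in>V. r y) / (2 * n) - 1 / 2"
    using n_pos by (simp add: field_simps)
  then show ?thesis using row[OF that] by simp
qed

lemma tr1_eq: "tr1 = n - 1 + (\<Sum>x\<in>V. r x) / n"
proof -
  have "n * tr1 = (\<Sum>x\<in>V. n + 2 * (n * q x))"
    unfolding tr1_def sum_distrib_left
    by (rule sum.cong) (auto simp: q_def field_simps)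
  also have "\<dots> = (\<Sum>x\<in>V. n + 2 * (r x - 1 / 2 - (\<Sum>y\<in>V. r y) / (2 * n)))"
    by (rule sum.cong) (auto simp: n_times_q)
  also have "\<dots> = n * n + 2 * ((\<Sum>x\<in>V. r x) - n * (1/2) - n * ((\<Sum>y\<in>V. r y) / (2 * n)))"
    by (simp add: sum.distrib sum_subtractf sum_distrib_left[symmetric])
  also have "\<dots> = n * (n - 1 + (\<Sum>x\<in>V. r x) / n)"
    using n_pos by (simp add: field_simps)
  finally show ?thesis using n_pos by simp
qed

lemma trAU: "(\<Sum>x\<in>V. \<Sum>y\<in>V. U x y * A x y) = 2 * (\<Sum>x\<in>V. q x * r x) - trU2"
proof -
  have "(\<Sum>x\<in>V. U x y) = r y" for y
    unfolding r_def by (rule sum.cong) (auto simp: U_sym)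
  then show ?thesis
    unfolding A_contract trU2_def by (simp add: r_def)
qed

lemma tr2_eq: "tr2 = tr1 + trU2 - 2 * (\<Sum>x\<in>V. q x * r x)"
proof -
  have "tr2 = tr1 - (\<Sum>x\<in>V. \<Sum>y\<in>V. A x y * U x y)"
    unfolding tr2_def A_contract[of A] tr1_def by (simp add: A_row_sum A_col_sum)
  then show ?thesis using trAU by (simp add: mult.commute)
qed

text \<open>The factors of the cube of \<open>A\<close> are replaced by \<open>A_contract\<close>
  one after another, until only the trace of the cube of \<open>U\<close> and terms in
  \<open>q\<close>, \<open>r\<close> and \<open>U\<close> remain.\<close>

lemma tr3_eq:
  assumes triangle_free: "\<And>x y z. x \<in> V \<Longrightarrow> y \<in> V \<Longrightarrow> z \<in> V \<Longrightarrow> U x y * U x z * U y z = 0"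
  shows "tr3 = tr2 + 2 * trU2 - 3 * (\<Sum>x\<in>V. q x * r x)
    + 3 * (\<Sum>x\<in>V. \<Sum>y\<in>V. r x * q y * U x y)
    - (\<Sum>x\<in>V. q x) * (\<Sum>x\<in>V. q x * r x) - (\<Sum>x\<in>V. r x) * (\<Sum>x\<in>V. q x * q x)"
proof -
  have rowU: "(\<Sum>x\<in>V. U x y) = r y" for y
    unfolding r_def by (rule sum.cong) (auto simp: U_sym)
  \<comment> \<open>By symmetry \<open>F\<close>, \<open>H\<close> and \<open>W\<close> are the
    products \<open>AA\<close>, \<open>AU\<close> and \<open>UU\<close>.\<close>
  define F where "F x z = (\<Sum>y\<in>V. A x y * A y z)" for x z
  define H where "H y z = (\<Sum>x\<in>V. A x y * U x z)" for y z
  define W where "W x y = (\<Sum>z\<in>V. U x z * U y z)" for x y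
  have "(\<Sum>z\<in>V. F x z) = (\<Sum>y\<in>V. A x y * (\<Sum>z\<in>V. A y z))" for x
    unfolding F_def sum_distrib_left by (rule sum.swap)
  then have F_row: "(\<Sum>z\<in>V. F x z) = 0" for x by (simp add: A_row_sum)
  have "(\<Sum>x\<in>V. F x z) = (\<Sum>y\<in>V. A y z * (\<Sum>x\<in>V. A x y))" for z
    unfolding F_def sum_distrib_left by (subst sum.swap) (simp add: mult.commute)
  then have F_col: "(\<Sum>x\<in>V. F x z) = 0" for z by (simp add: A_col_sum)
  have "(\<Sum>x\<in>V. F x x) = tr2"
    unfolding F_def tr2_def by (intro sum.cong refl) (simp add: A_sym)
  then have 1: "tr3 = tr2 - (\<Sum>x\<in>V. \<Sum>z\<in>V. F x z * U x z)"
    unfolding tr3_def F_def[symmetric] A_contract[of F] by (simp add: F_row F_col)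
  have "(\<Sum>x\<in>V. \<Sum>z\<in>V. F x z * U x z) = (\<Sum>x\<in>V. \<Sum>y\<in>V. \<Sum>z\<in>V. A x y * U x z * A y z)"
    unfolding F_def sum_distrib_right
    by (rule sum.cong[OF refl], subst sum.swap) (simp add: mult_ac)
  also have "\<dots> = (\<Sum>y\<in>V. \<Sum>x\<in>V. \<Sum>z\<in>V. A x y * U x z * A y z)"
    by (rule sum.swap)
  also have "\<dots> = (\<Sum>y\<in>V. \<Sum>z\<in>V. H y z * A y z)"
    unfolding H_def sum_distrib_right
    by (rule sum.cong[OF refl], subst sum.swap) simp
  finally have 2: "(\<Sum>x\<in>V. \<Sum>z\<in>V. F x z * U x z) = (\<Sum>y\<in>V. \<Sum>z\<in>V. H y z * A y z)" .
  have "(\<Sum>y\<in>V. H y z) = (\<Sum>x\<in>V. U x z * (\<Sum>y\<in>V. A x y))" for z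
    unfolding H_def sum_distrib_left by (subst sum.swap) (simp add: mult.commute)
  then have H_col: "(\<Sum>y\<in>V. H y z) = 0" for z by (simp add: A_row_sum)
  have H_row: "(\<Sum>z\<in>V. H y z) = (\<Sum>x\<in>V. A x y * r x)" for y
    unfolding H_def r_def sum_distrib_left by (rule sum.swap)
  have "(\<Sum>y\<in>V. H y y) = (\<Sum>x\<in>V. \<Sum>y\<in>V. U x y * A x y)"
    unfolding H_def by (subst sum.swap) (simp add: mult.commute)
  moreover have "(\<Sum>y\<in>V. q y * (\<Sum>z\<in>V. H y z)) = (\<Sum>x\<in>V. \<Sum>y\<in>V. (r x * q y) * A x y)"
    unfolding H_row sum_distrib_left by (subst sum.swap) (simp add: mult_ac)
  \<comment> \<open>The column sums of \<open>H\<close> vanish but its row sums do not, which leaves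
    a pairing of \<open>A\<close> with the rank-one matrix of entries
    \<open>r x * q y\<close>.\<close>
  ultimately have 3: "(\<Sum>y\<in>V. \<Sum>z\<in>V. H y z * A y z) = 2 * (\<Sum>x\<in>V. q x * r x) - trU2
      - (\<Sum>y\<in>V. \<Sum>z\<in>V. H y z * U y z) + (\<Sum>x\<in>V. \<Sum>y\<in>V. (r x * q y) * A x y)"
    unfolding A_contract[of H] by (simp add: H_col trAU)
  have "(\<Sum>y\<in>V. \<Sum>z\<in>V. H y z * U y z) = (\<Sum>y\<in>V. \<Sum>x\<in>V. \<Sum>z\<in>V. A x y * U x z * U y z)"
    unfolding H_def sum_distrib_right
    by (rule sum.cong[OF refl], subst sum.swap) simp
  also have "\<dots> = (\<Sum>x\<in>V. \<Sum>y\<in>V. W x y * A x y)"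
    unfolding W_def sum_distrib_right by (subst sum.swap) (simp add: mult_ac)
  finally have 4: "(\<Sum>y\<in>V. \<Sum>z\<in>V. H y z * U y z) = (\<Sum>x\<in>V. \<Sum>y\<in>V. W x y * A x y)" .
  have W_sym: "W x y = W y x" for x y
    by (simp add: W_def mult.commute)
  have W_row: "(\<Sum>y\<in>V. W x y) = (\<Sum>z\<in>V. U x z * r z)" for x
    unfolding W_def rowU[symmetric] sum_distrib_left by (rule sum.swap)
  moreover have "(\<Sum>y\<in>V. W y x) = (\<Sum>y\<in>V. W x y)" for x
    by (intro sum.cong refl W_sym)
  ultimately have W_col: "(\<Sum>y\<in>V. W y x) = (\<Sum>z\<in>V. U x z * r z)" for x
    by simp
  \<comment> \<open>This is the trace of the cube of \<open>U\<close>, and the only place where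
    triangle-freeness enters.\<close>
  have "(\<Sum>x\<in>V. \<Sum>y\<in>V. W x y * U x y) = 0"
    unfolding W_def sum_distrib_right
    using triangle_free by (intro sum.neutral ballI) (simp add: mult_ac)
  moreover have "(\<Sum>x\<in>V. W x x) = trU2"
    by (simp add: W_def trU2_def)
  moreover have "(\<Sum>x\<in>V. q x * (\<Sum>z\<in>V. U x z * r z)) = (\<Sum>x\<in>V. \<Sum>y\<in>V. r x * q y * U x y)"
    unfolding sum_distrib_left by (subst sum.swap) (simp add: mult_ac U_sym)
  ultimately have 5: "(\<Sum>x\<in>V. \<Sum>y\<in>V. W x y * A x y)
      = trU2 + 2 * (\<Sum>x\<in>V. \<Sum>y\<in>V. r x * q y * U x y)"
    unfolding A_contract[of W] W_row W_col by simp
  have "(\<Sum>x\<in>V. q x * (\<Sum>y\<in>V. r x * q y)) = (\<Sum>x\<in>V. q x) * (\<Sum>x\<in>V. q x * r x)"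
    unfolding sum_product by (subst sum.swap) (simp add: sum_distrib_left mult_ac)
  moreover have "(\<Sum>y\<in>V. q y * (\<Sum>x\<in>V. r x * q y)) = (\<Sum>x\<in>V. r x) * (\<Sum>x\<in>V. q x * q x)"
    unfolding sum_product by (subst sum.swap) (simp add: sum_distrib_left mult_ac)
  ultimately have 6: "(\<Sum>x\<in>V. \<Sum>y\<in>V. (r x * q y) * A x y) = (\<Sum>x\<in>V. q x * r x)
      - (\<Sum>x\<in>V. \<Sum>y\<in>V. r x * q y * U x y) + (\<Sum>x\<in>V. q x) * (\<Sum>x\<in>V. q x * r x)
      + (\<Sum>x\<in>V. r x) * (\<Sum>x\<in>V. q x * q x)"
    unfolding A_contract by (simp add: mult.commute)
  show ?thesis using 1 2 3 4 5 6 by simp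
qed

section \<open>Trace inequalities from rank and semidefiniteness\<close>

text \<open>\<open>A\<close> is twice \<open>f\<close> times its transpose, so its first two traces
  agree with those of twice the d by d matrix \<open>S\<close>, the product in the other order.
  Cauchy-Schwarz on the diagonal of \<open>S\<close> then replaces the rank argument.\<close>

lemma tr1_sq_le: "tr1\<^sup>2 \<le> d * tr2"
proof -
  define S where "S i j = (\<Sum>x\<in>V. f x i * f x j)" for i j
  have "tr1 = 2 * (\<Sum>i<d. S i i)"
    unfolding tr1_def A_def S_def sum_distrib_left by (rule sum.swap)
  then have "tr1\<^sup>2 = 4 * (\<Sum>i<d. 1 * S i i)\<^sup>2" by (simp add: power_mult_distrib)
  also have "\<dots> \<le> 4 * ((\<Sum>i<d. 1\<^sup>2) * (\<Sum>i<d. (S i i)\<^sup>2))"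
    by (intro mult_left_mono Cauchy_Schwarz_ineq_sum) auto
  also have "\<dots> = 4 * d * (\<Sum>i<d. (S i i)\<^sup>2)" by simp
  also have "\<dots> \<le> 4 * d * (\<Sum>i<d. \<Sum>j<d. (S i j)\<^sup>2)"
    by (intro mult_left_mono sum_mono member_le_sum) auto
  also have "\<dots> = d * (4 * (\<Sum>i<d. \<Sum>j<d. (S i j)\<^sup>2))" by simp
  also have "4 * (\<Sum>i<d. \<Sum>j<d. (S i j)\<^sup>2) = tr2"
  proof -
    have "tr2 = 4 * (\<Sum>x\<in>V. \<Sum>y\<in>V. \<Sum>i<d. \<Sum>j<d. (f x i * f x j) * (f y i * f y j))"
      unfolding tr2_def A_def sum_product sum_distrib_left
      by (intro sum.cong refl) (simp add: sum_product sum_distrib_left mult_ac)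
    also have "(\<Sum>x\<in>V. \<Sum>y\<in>V. \<Sum>i<d. \<Sum>j<d. (f x i * f x j) * (f y i * f y j))
        = (\<Sum>x\<in>V. \<Sum>i<d. \<Sum>j<d. \<Sum>y\<in>V. (f x i * f x j) * (f y i * f y j))"
      by (intro sum.cong refl) (subst sum.swap, intro sum.cong refl, rule sum.swap)
    also have "\<dots> = (\<Sum>i<d. \<Sum>j<d. \<Sum>x\<in>V. \<Sum>y\<in>V. (f x i * f x j) * (f y i * f y j))"
      by (subst sum.swap, intro sum.cong refl, rule sum.swap)
    also have "\<dots> = (\<Sum>i<d. \<Sum>j<d. (S i j)\<^sup>2)"
      by (simp add: S_def power2_eq_square sum_product)
    finally show ?thesis by simp
  qed
  finally show ?thesis .
qed

text \<open>Cauchy-Schwarz for the matrices \<open>f\<close> and \<open>y = A f\<close> in the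
  Frobenius inner product: up to the factor 2, the three traces are the square norm of
  \<open>f\<close>, their inner product and the square norm of \<open>y\<close>. Semidefiniteness
  enters through this factorisation.\<close>

lemma tr2_sq_le: "tr2\<^sup>2 \<le> tr1 * tr3"
proof -
  define y where "y x i = (\<Sum>z\<in>V. A x z * f z i)" for x i
  have t2: "tr2 = 2 * (\<Sum>(x,i)\<in>V\<times>{..<d}. f x i * y x i)"
  proof -
    have "tr2 = (\<Sum>x\<in>V. \<Sum>z\<in>V. \<Sum>i<d. 2 * (f x i * (A x z * f z i)))"
      unfolding tr2_def
      by (intro sum.cong refl, subst (2) A_def) (simp add: sum_distrib_left mult_ac)
    also have "\<dots> = (\<Sum>x\<in>V. \<Sum>i<d. 2 * (f x i * y x i))"
      unfolding y_def sum_distrib_left by (intro sum.cong refl) (rule sum.swap)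
    finally show ?thesis by (simp add: sum.cartesian_product[symmetric] sum_distrib_left)
  qed
  have t1: "tr1 = 2 * (\<Sum>(x,i)\<in>V\<times>{..<d}. (f x i)\<^sup>2)"
    by (simp add: tr1_def A_def sum.cartesian_product[symmetric] sum_distrib_left power2_eq_square)
  have t3: "tr3 = 2 * (\<Sum>(x,i)\<in>V\<times>{..<d}. (y x i)\<^sup>2)"
  proof -
    have y_sq: "(y x i)\<^sup>2 = (\<Sum>z\<in>V. \<Sum>w\<in>V. A x z * f z i * (A x w * f w i))" for x i
      by (simp add: y_def power2_eq_square sum_product)
    have "2 * (\<Sum>(x,i)\<in>V\<times>{..<d}. (y x i)\<^sup>2)
        = (\<Sum>x\<in>V. \<Sum>i<d. \<Sum>z\<in>V. \<Sum>w\<in>V. 2 * (A x z * f z i * (A x w * f w i)))"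
      by (simp add: sum.cartesian_product[symmetric] y_sq sum_distrib_left)
    also have "\<dots> = (\<Sum>x\<in>V. \<Sum>z\<in>V. \<Sum>w\<in>V. \<Sum>i<d. 2 * (A x z * f z i * (A x w * f w i)))"
      by (intro sum.cong refl) (subst sum.swap, intro sum.cong refl, rule sum.swap)
    also have "\<dots> = (\<Sum>x\<in>V. \<Sum>z\<in>V. \<Sum>w\<in>V. A x z * A z w * A x w)"
      by (intro sum.cong refl, subst (2) A_def) (simp add: sum_distrib_left sum_distrib_right mult_ac)
    also have "\<dots> = tr3"
      unfolding tr3_def sum_distrib_right
      by (rule sum.cong[OF refl], subst sum.swap) (simp add: mult_ac A_sym)
    finally show ?thesis by simp
  qed
  have "(\<Sum>(x,i)\<in>V\<times>{..<d}. f x i * y x i)\<^sup>2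
      \<le> (\<Sum>(x,i)\<in>V\<times>{..<d}. (f x i)\<^sup>2) * (\<Sum>(x,i)\<in>V\<times>{..<d}. (y x i)\<^sup>2)"
    using Cauchy_Schwarz_ineq_sum[of "\<lambda>(x,i). f x i" "\<lambda>(x,i). y x i" "V\<times>{..<d}"]
    by (simp add: case_prod_unfold)
  then show ?thesis unfolding t1 t2 t3 by (simp add: power_mult_distrib)
qed

lemma tr1_cube_le:
  assumes "tr1 > 0"
  shows "tr1 ^ 3 \<le> (real d)\<^sup>2 * tr3"
proof -
  have "(tr1\<^sup>2)\<^sup>2 \<le> (d * tr2)\<^sup>2"
    using tr1_sq_le by (intro power_mono) auto
  also have "\<dots> \<le> (real d)\<^sup>2 * (tr1 * tr3)"
    using tr2_sq_le by (simp add: power_mult_distrib mult_left_mono)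
  finally have "tr1 * tr1 ^ 3 \<le> tr1 * ((real d)\<^sup>2 * tr3)"
    by (simp add: power2_eq_square power3_eq_cube mult_ac)
  then show ?thesis using assms by simp
qed

text \<open>With \<open>U = 0\<close> both \<open>tr1\<close> and \<open>tr2\<close> equal
  \<open>n - 1\<close>, so the rank inequality already gives the bound on unit simplices.\<close>

lemma clique_card:
  assumes "\<And>x y. x \<in> V \<Longrightarrow> y \<in> V \<Longrightarrow> U x y = 0"
  shows "card V \<le> d + 1"
proof -
  have r0: "r x = 0" if "x \<in> V" for x using assms that by (simp add: r_def)
  then have "tr1 = n - 1" by (simp add: tr1_eq)
  moreover have "tr2 = tr1" using r0 assms by (simp add: tr2_eq trU2_def)
  ultimately have "(n - 1)\<^sup>2 \<le> d * (n - 1)" using tr1_sq_le by simp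
  moreover have "n - 1 \<ge> 0" using n_pos by (simp add: Suc_le_eq)
  ultimately have "n - 1 \<le> d"
    by (cases "n - 1 = 0") (auto simp: power2_eq_square)
  then show ?thesis by linarith
qed


section \<open>Absolute row sums of \<open>U\<close>\<close>

text \<open>The sum is twice the inner product of \<open>f x\<close> with a signed sum of the
  vectors of \<open>N\<close>. Those vectors are nearly orthogonal, since \<open>A y z\<close> is
  \<open>q y + q z\<close> for distinct \<open>y\<close>, \<open>z\<close> in \<open>N\<close>, so
  the signed sum is short and Cauchy-Schwarz applies.\<close>

lemma sum_abs_A_le:
  assumes N: "N \<subseteq> V" "\<And>y z. y \<in> N \<Longrightarrow> z \<in> N \<Longrightarrow> U y z = 0" and x: "x \<in> V"
    and Q: "\<And>y. y \<in> V \<Longrightarrow> \<bar>q y\<bar> \<le> Q"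
  shows "(\<Sum>y\<in>N. \<bar>A x y\<bar>)\<^sup>2 \<le> (1 + 2 * Q) * (card N + 2 * (real (card N))\<^sup>2 * Q)"
proof -
  have finN: "finite N" using N(1) fin by (rule finite_subset)
  define S where "S i = (\<Sum>y\<in>N. sgn (A x y) * f y i)" for i
  have Q0: "Q \<ge> 0" using Q[OF x] by linarith
  have "(\<Sum>y\<in>N. \<bar>A x y\<bar>) = (\<Sum>y\<in>N. sgn (A x y) * A x y)"
    by (intro sum.cong refl) (simp add: abs_sgn mult.commute)
  also have "\<dots> = (\<Sum>y\<in>N. \<Sum>i<d. 2 * (f x i * (sgn (A x y) * f y i)))"
    by (intro sum.cong refl, subst (2) A_def) (simp add: sum_distrib_left mult_ac)
  also have "\<dots> = 2 * (\<Sum>i<d. f x i * S i)"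
    unfolding S_def sum_distrib_left by (rule sum.swap)
  finally have "(\<Sum>y\<in>N. \<bar>A x y\<bar>)\<^sup>2 = 4 * (\<Sum>i<d. f x i * S i)\<^sup>2"
    by (simp add: power_mult_distrib)
  also have "\<dots> \<le> 4 * ((\<Sum>i<d. (f x i)\<^sup>2) * (\<Sum>i<d. (S i)\<^sup>2))"
    by (intro mult_left_mono Cauchy_Schwarz_ineq_sum) auto
  also have "\<dots> = A x x * (2 * (\<Sum>i<d. (S i)\<^sup>2))"
    by (simp add: A_def power2_eq_square)
  also have "2 * (\<Sum>i<d. (S i)\<^sup>2) = (\<Sum>y\<in>N. \<Sum>z\<in>N. sgn (A x y) * sgn (A x z) * A y z)"
  proof -
    have S_sq: "(S i)\<^sup>2 = (\<Sum>y\<in>N. \<Sum>z\<in>N. sgn (A x y) * f y i * (sgn (A x z) * f z i))" for i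
      by (simp add: S_def power2_eq_square sum_product)
    have "2 * (\<Sum>i<d. (S i)\<^sup>2) =
        (\<Sum>i<d. \<Sum>y\<in>N. \<Sum>z\<in>N. 2 * (sgn (A x y) * f y i * (sgn (A x z) * f z i)))"
      by (simp add: S_sq sum_distrib_left)
    also have "\<dots> = (\<Sum>y\<in>N. \<Sum>z\<in>N. \<Sum>i<d. 2 * (sgn (A x y) * f y i * (sgn (A x z) * f z i)))"
      by (subst sum.swap, intro sum.cong refl, rule sum.swap)
    also have "\<dots> = (\<Sum>y\<in>N. \<Sum>z\<in>N. sgn (A x y) * sgn (A x z) * A y z)"
      by (intro sum.cong refl, subst (5) A_def) (simp add: sum_distrib_left mult_ac)
    finally show ?thesis .
  qed
  also have "A x x * \<dots> \<le> (1 + 2 * Q) * (card N + 2 * (real (card N))\<^sup>2 * Q)"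
  proof (rule mult_mono)
    show "A x x \<le> 1 + 2 * Q" using Q[OF x] by (simp add: q_def)
    show "0 \<le> 1 + 2 * Q" using Q0 by simp
    have "(\<Sum>y\<in>N. \<Sum>z\<in>N. sgn (A x y) * sgn (A x z) * A y z)
        \<le> (\<Sum>y\<in>N. \<Sum>z\<in>N. of_bool (y = z) + 2 * Q)"
    proof (intro sum_mono)
      fix y z assume yz: "y \<in> N" "z \<in> N"
      have "sgn (A x y) * sgn (A x z) * A y z \<le> \<bar>sgn (A x y) * sgn (A x z) * A y z\<bar>" by simp
      also have "\<dots> \<le> 1 * \<bar>A y z\<bar>"
        unfolding abs_mult by (intro mult_right_mono) (auto simp: sgn_if)
      also have "\<bar>A y z\<bar> = \<bar>of_bool (y = z) + q y + q z\<bar>"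
        using N(2)[OF yz] by (simp add: A_eq[of y z])
      also have "\<dots> \<le> of_bool (y = z) + 2 * Q"
      proof -
        have "\<bar>q y\<bar> \<le> Q" "\<bar>q z\<bar> \<le> Q" using Q yz N(1) by auto
        then show ?thesis by (auto simp: of_bool_def abs_le_iff)
      qed
      finally show "sgn (A x y) * sgn (A x z) * A y z \<le> of_bool (y = z) + 2 * Q" by simp
    qed
    also have "\<dots> = (\<Sum>y\<in>N. 1 + card N * (2 * Q))"
      using finN by (intro sum.cong refl) (simp add: sum.distrib of_bool_def)
    also have "\<dots> = card N + 2 * (real (card N))\<^sup>2 * Q"
      by (simp add: algebra_simps power2_eq_square)
    finally show "(\<Sum>y\<in>N. \<Sum>z\<in>N. sgn (A x y) * sgn (A x z) * A y z)
      \<le> card N + 2 * (real (card N))\<^sup>2 * Q" .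
    \<comment> \<open>\<open>mult_mono\<close> needs this sign; it is visible only in the form of a
      squared norm.\<close>
    have "0 \<le> 2 * (\<Sum>i<d. (S i)\<^sup>2)" by (simp add: sum_nonneg)
    then show "0 \<le> (\<Sum>y\<in>N. \<Sum>z\<in>N. sgn (A x y) * sgn (A x z) * A y z)"
      by (simp add: \<open>2 * (\<Sum>i<d. (S i)\<^sup>2) = _\<close>)
  qed
  finally show ?thesis .
qed

text \<open>By triangle-freeness \<open>U\<close> vanishes between any two points of the support
  \<open>N\<close> of row \<open>x\<close>, so \<open>sum_abs_A_le\<close> applies to
  \<open>N\<close>. Off the diagonal \<open>U\<close> and \<open>-A\<close> differ by at most
  \<open>2 * Q\<close>.\<close>

lemma sum_abs_U_le:
  assumes triangle_free: "\<And>x y z. x \<in> V \<Longrightarrow> y \<in> V \<Longrightarrow> z \<in> V \<Longrightarrow> U x y * U x z * U y z = 0"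
    and m: "card {y\<in>V. U x y \<noteq> 0} \<le> m" and x: "x \<in> V"
    and Q: "\<And>y. y \<in> V \<Longrightarrow> \<bar>q y\<bar> \<le> Q"
  shows "(\<Sum>y\<in>V. \<bar>U x y\<bar>) \<le> 2 * m * Q + sqrt ((1 + 2 * Q) * (m + 2 * (real m)\<^sup>2 * Q))"
proof -
  define N where "N = {y\<in>V. U x y \<noteq> 0}"
  have Q0: "Q \<ge> 0" using Q[OF x] by linarith
  have N: "N \<subseteq> V" "\<And>y z. y \<in> N \<Longrightarrow> z \<in> N \<Longrightarrow> U y z = 0"
    using triangle_free[OF x] by (auto simp: N_def)
  have "(\<Sum>y\<in>N. \<bar>A x y\<bar>)\<^sup>2 \<le> (1 + 2 * Q) * (card N + 2 * (real (card N))\<^sup>2 * Q)"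
    using sum_abs_A_le[OF N x Q] by simp
  also have "\<dots> \<le> (1 + 2 * Q) * (m + 2 * (real m)\<^sup>2 * Q)"
    using Q0 m by (intro mult_left_mono add_mono mult_right_mono power_mono) (auto simp: N_def)
  finally have sqrt: "(\<Sum>y\<in>N. \<bar>A x y\<bar>) \<le> sqrt ((1 + 2 * Q) * (m + 2 * (real m)\<^sup>2 * Q))"
    by (rule real_le_rsqrt)
  have "(\<Sum>y\<in>V. \<bar>U x y\<bar>) = (\<Sum>y\<in>N. \<bar>U x y\<bar>)"
    unfolding N_def using fin by (intro sum.mono_neutral_right) auto
  also have "\<dots> \<le> (\<Sum>y\<in>N. \<bar>A x y\<bar> + 2 * Q)"
  proof (rule sum_mono)
    fix y assume "y \<in> N"
    then have "y \<in> V" "x \<noteq> y" by (auto simp: N_def)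
    then show "\<bar>U x y\<bar> \<le> \<bar>A x y\<bar> + 2 * Q"
      using Q[OF x] Q[of y] A_eq[of x y] by auto
  qed
  also have "\<dots> = (\<Sum>y\<in>N. \<bar>A x y\<bar>) + 2 * card N * Q"
    by (simp add: sum.distrib)
  also have "2 * card N * Q \<le> 2 * m * Q"
    using Q0 m by (intro mult_right_mono) (auto simp: N_def)
  finally show ?thesis using sqrt by linarith
qed

section \<open>Estimates in terms of a bound \<open>R\<close> on the absolute row sums\<close>

context
  fixes R :: real
  assumes R: "\<And>x. x \<in> V \<Longrightarrow> (\<Sum>y\<in>V. \<bar>U x y\<bar>) \<le> R"
begin

lemma abs_r_le: "x \<in> V \<Longrightarrow> \<bar>r x\<bar> \<le> R"
  unfolding r_def by (rule order_trans[OF sum_abs R])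

lemma R_nonneg: "R \<ge> 0"
proof -
  obtain x where "x \<in> V" using nonempty by blast
  then show ?thesis using abs_r_le[of x] by linarith
qed

lemma abs_sum_le: "(\<And>x. x \<in> V \<Longrightarrow> \<bar>F x\<bar> \<le> c) \<Longrightarrow> \<bar>\<Sum>x\<in>V. F x\<bar> \<le> n * c"
  for F :: "'a \<Rightarrow> real"
  by (rule order_trans[OF sum_abs sum_bounded_above])

lemma abs_q_le: "x \<in> V \<Longrightarrow> \<bar>q x\<bar> \<le> (3 * R + 1) / (2 * n)"
proof -
  assume x: "x \<in> V"
  define s where "s = (\<Sum>y\<in>V. r y) / (2 * n)"
  have "\<bar>\<Sum>y\<in>V. r y\<bar> \<le> n * R" by (rule abs_sum_le) (rule abs_r_le)
  then have "\<bar>s\<bar> \<le> R / 2"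
    using n_pos by (simp add: s_def field_simps)
  moreover have "n * q x = r x - 1 / 2 - s"
    using n_times_q[OF x] by (simp add: s_def)
  ultimately have "\<bar>n * q x\<bar> \<le> (3 * R + 1) / 2"
    using abs_r_le[OF x] by (simp only: abs_le_iff) (simp add: field_simps)
  then show ?thesis using n_pos by (simp add: abs_mult field_simps)
qed

lemma abs_sum_r_div_le: "\<bar>(\<Sum>x\<in>V. r x) / n\<bar> \<le> R"
  using abs_sum_le[of r R] abs_r_le n_pos by (simp add: field_simps)

text \<open>Here \<open>c\<close> bounds \<open>n\<close> times every \<open>q x\<close>, so each
  sum in \<open>tr3_eq\<close> is bounded by a product of powers of \<open>R\<close> and
  \<open>c\<close>. The main term \<open>9 * n * R\<close> is three copies of
  \<open>trU2 <= 3 * n * R\<close>, one of them from \<open>tr2_eq\<close>.\<close>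

lemma tr3_le:
  assumes triangle_free: "\<And>x y z. x \<in> V \<Longrightarrow> y \<in> V \<Longrightarrow> z \<in> V \<Longrightarrow> U x y * U x z * U y z = 0"
    and U3: "\<And>x y. x \<in> V \<Longrightarrow> y \<in> V \<Longrightarrow> \<bar>U x y\<bar> \<le> 3"
  defines "c \<equiv> (3 * R + 1) / 2"
  shows "tr3 \<le> n + R + 9 * n * R + 5 * R * c + 3 * R\<^sup>2 * c + 2 * R * c\<^sup>2"
proof -
  note R0 = R_nonneg
  define Q where "Q = c / n"
  have nQ: "n * Q = c" using n_pos by (simp add: Q_def)
  have Q0: "Q \<ge> 0" using R0 by (simp add: Q_def c_def)
  have q: "\<bar>q x\<bar> \<le> Q" if "x \<in> V" for x
    using abs_q_le[OF that] by (simp add: Q_def c_def field_simps)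
  have qr: "\<bar>\<Sum>x\<in>V. q x * r x\<bar> \<le> R * c"
  proof -
    have "\<bar>\<Sum>x\<in>V. q x * r x\<bar> \<le> n * (Q * R)"
      by (rule abs_sum_le) (auto simp: abs_mult intro!: mult_mono q abs_r_le Q0)
    then show ?thesis by (simp add: mult_ac flip: nQ)
  qed
  have sq: "\<bar>\<Sum>x\<in>V. q x\<bar> \<le> c"
    using abs_sum_le[of q Q] q nQ by simp
  have "\<bar>\<Sum>x\<in>V. q x * q x\<bar> \<le> n * (Q * Q)"
    by (rule abs_sum_le, unfold abs_mult) (intro mult_mono q Q0 abs_ge_zero)
  moreover have "\<bar>\<Sum>x\<in>V. r x\<bar> \<le> n * R" by (rule abs_sum_le) (rule abs_r_le)
  ultimately have "\<bar>\<Sum>x\<in>V. r x\<bar> * \<bar>\<Sum>x\<in>V. q x * q x\<bar> \<le> (n * R) * (n * (Q * Q))"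
    using R0 by (intro mult_mono) auto
  also have "\<dots> = R * (n * Q)\<^sup>2" by (simp add: power2_eq_square)
  finally have 1: "\<bar>(\<Sum>x\<in>V. r x) * (\<Sum>x\<in>V. q x * q x)\<bar> \<le> R * c\<^sup>2"
    unfolding nQ by (simp add: abs_mult)
  have "\<bar>\<Sum>x\<in>V. q x\<bar> * \<bar>\<Sum>x\<in>V. q x * r x\<bar> \<le> c * (R * c)"
    using sq qr by (intro mult_mono) (auto intro: order_trans[OF abs_ge_zero])
  then have 2: "\<bar>(\<Sum>x\<in>V. q x) * (\<Sum>x\<in>V. q x * r x)\<bar> \<le> R * c\<^sup>2"
    by (simp add: abs_mult power2_eq_square mult_ac)
  have "\<bar>\<Sum>x\<in>V. \<Sum>y\<in>V. r x * q y * U x y\<bar> \<le> n * (R * (Q * R))"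
  proof (rule abs_sum_le)
    fix x assume x: "x \<in> V"
    have "\<bar>\<Sum>y\<in>V. r x * q y * U x y\<bar> \<le> (\<Sum>y\<in>V. \<bar>r x * q y * U x y\<bar>)" by (rule sum_abs)
    also have "\<dots> \<le> (\<Sum>y\<in>V. R * (Q * \<bar>U x y\<bar>))"
      unfolding abs_mult mult.assoc
      using x R0 Q0 by (intro sum_mono mult_mono q abs_r_le) auto
    also have "\<dots> = R * (Q * (\<Sum>y\<in>V. \<bar>U x y\<bar>))" by (simp add: sum_distrib_left)
    also have "\<dots> \<le> R * (Q * R)"
      using R[OF x] R0 Q0 by (intro mult_left_mono) auto
    finally show "\<bar>\<Sum>y\<in>V. r x * q y * U x y\<bar> \<le> R * (Q * R)" .
  qed
  also have "\<dots> = R\<^sup>2 * (n * Q)" by (simp add: power2_eq_square)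
  finally have 3: "\<bar>\<Sum>x\<in>V. \<Sum>y\<in>V. r x * q y * U x y\<bar> \<le> R\<^sup>2 * c" unfolding nQ .
  have "trU2 \<le> (\<Sum>x\<in>V. \<Sum>y\<in>V. 3 * \<bar>U x y\<bar>)"
    unfolding trU2_def
  proof (intro sum_mono)
    fix x y assume "x \<in> V" "y \<in> V"
    then have "\<bar>U x y\<bar> * \<bar>U x y\<bar> \<le> 3 * \<bar>U x y\<bar>" by (intro mult_right_mono U3) auto
    then show "U x y * U x y \<le> 3 * \<bar>U x y\<bar>" by simp
  qed
  also have "\<dots> = (\<Sum>x\<in>V. 3 * (\<Sum>y\<in>V. \<bar>U x y\<bar>))" by (simp add: sum_distrib_left)
  also have "\<dots> \<le> n * (3 * R)" using R by (intro sum_bounded_above) auto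
  finally have 4: "trU2 \<le> 3 * n * R" by simp
  have 5: "tr1 \<le> n + R" using tr1_eq abs_sum_r_div_le by linarith
  show ?thesis
    using tr3_eq[OF triangle_free] tr2_eq 1 2 3 4 5 qr
    by (simp add: abs_le_iff)
qed

end

section \<open>The numerical contradiction\<close>

text \<open>With \<open>e\<close> the cube root of \<open>d\<close>, assuming
  \<open>n >= 40 * e ^ 4\<close> yields first \<open>R <= 6 * e ^ 2\<close>, then
  \<open>tr3 <= 120 * n * e ^ 2\<close>. As \<open>tr1 >= n / 2\<close>, the cubic trace inequality
  then forces \<open>n ^ 2 <= 960 * e ^ 8\<close>, against \<open>1600 * e ^ 8\<close>.\<close>

lemma card_lt:
  assumes triangle_free: "\<And>x y z. x \<in> V \<Longrightarrow> y \<in> V \<Longrightarrow> z \<in> V \<Longrightarrow> U x y * U x z * U y z = 0"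
    and U3: "\<And>x y. x \<in> V \<Longrightarrow> y \<in> V \<Longrightarrow> \<bar>U x y\<bar> \<le> 3"
    and m: "\<And>x. x \<in> V \<Longrightarrow> card {y\<in>V. U x y \<noteq> 0} \<le> d + 1"
    and e: "e \<ge> 1" "e ^ 3 = real d"
  shows "n < 40 * e ^ 4"
proof (rule ccontr)
  assume "\<not> ?thesis"
  then have n: "40 * e ^ 4 \<le> n" by simp
  have e_powers: "e \<le> e ^ 2" "1 \<le> e ^ 2" "1 \<le> e ^ 3" "e ^ 3 \<le> e ^ 4" "e ^ 2 \<le> e ^ 4" "1 \<le> e ^ 4"
    "e ^ 2 \<le> e ^ 6" "e ^ 4 \<le> e ^ 6"
    using e(1) power_increasing[of _ _ e] self_le_power[of e 2] by (auto simp: one_le_power)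
  \<comment> \<open>The maximum is attained, so the row estimate at the maximising \<open>x\<close>,
    whose error \<open>Q\<close> depends on \<open>R\<close>, becomes an inequality for
    \<open>R\<close> itself.\<close>
  define R where "R = Max ((\<lambda>x. \<Sum>y\<in>V. \<bar>U x y\<bar>) ` V)"
  have R: "(\<Sum>y\<in>V. \<bar>U x y\<bar>) \<le> R" if "x \<in> V" for x
    unfolding R_def using fin that by (intro Max_ge) auto
  have "R \<in> (\<lambda>x. \<Sum>y\<in>V. \<bar>U x y\<bar>) ` V"
    unfolding R_def using fin nonempty by (intro Max_in) auto
  then obtain x where x: "x \<in> V" and Rx: "R = (\<Sum>y\<in>V. \<bar>U x y\<bar>)" by auto
  have R0: "R \<ge> 0" unfolding Rx by (simp add: sum_nonneg)
  have m2: "real (d + 1) \<le> 2 * e ^ 3" using e e_powers by simp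
  \<comment> \<open>A crude bound from the support size, needed only to get
    \<open>Q <= 1 / 4\<close> below.\<close>
  have "R = (\<Sum>y\<in>{y\<in>V. U x y \<noteq> 0}. \<bar>U x y\<bar>)"
    unfolding Rx using fin by (intro sum.mono_neutral_right) auto
  also have "\<dots> \<le> card {y\<in>V. U x y \<noteq> 0} * (3::real)"
    using U3 x by (intro sum_bounded_above) auto
  also have "\<dots> \<le> real (d + 1) * 3"
    using m[OF x] by (intro mult_right_mono) linarith+
  finally have R6: "R \<le> 6 * e ^ 3" using m2 by simp
  define Q where "Q = (3 * R + 1) / (2 * n)"
  have Q: "\<bar>q y\<bar> \<le> Q" if "y \<in> V" for y
    unfolding Q_def using abs_q_le[OF R that] .
  have Q0: "Q \<ge> 0" using R0 by (simp add: Q_def)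
  have Q_le: "Q \<le> (3 * R + 1) / (80 * e ^ 4)"
    unfolding Q_def using R0 n e_powers by (intro divide_left_mono mult_pos_pos) auto
  have R_le: "R \<le> 6 * e ^ 2"
  proof (rule ccontr)
    assume "\<not> ?thesis"
    then have R_gt: "6 * e ^ 2 < R" by simp
    then have R6': "6 < R" using e_powers by simp
    have "(3 * R + 1) / (80 * e ^ 4) \<le> 1 / 4"
    proof -
      have "3 * R + 1 \<le> 20 * e ^ 4" using R6 e_powers by linarith
      then show ?thesis using e_powers by (simp add: divide_le_eq)
    qed
    with Q_le have "Q \<le> 1 / 4" by (rule order_trans)
    then have Q1: "1 + 2 * Q \<le> 3 / 2" by simp
    have dQ: "2 * real (d + 1) * Q \<le> (3 * R + 1) / 20"
    proof -
      have "2 * real (d + 1) * Q \<le> 2 * (2 * e ^ 3) * ((3 * R + 1) / (80 * e ^ 4))"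
        using m2 Q_le Q0 e_powers e(1) by (intro mult_mono) auto
      also have "\<dots> = (3 * R + 1) / 20 * (e ^ 3 / e ^ 4)"
        using e(1) by (simp add: field_simps)
      also have "\<dots> \<le> (3 * R + 1) / 20 * 1"
        using R0 e_powers e(1) by (intro mult_left_mono) (simp_all add: divide_le_eq_1)
      finally show ?thesis by simp
    qed
    have ddQ: "2 * (real (d + 1))\<^sup>2 * Q \<le> e ^ 2 * (3 * R + 1) / 10"
    proof -
      have "2 * (real (d + 1))\<^sup>2 * Q \<le> 2 * (2 * e ^ 3)\<^sup>2 * ((3 * R + 1) / (80 * e ^ 4))"
        using m2 Q_le Q0 e_powers e(1) by (intro mult_mono power_mono) auto
      also have "\<dots> = e ^ 2 * (3 * R + 1) / 10"
        using e(1) by (simp add: field_simps power_mult_distrib flip: power_add power_mult)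
      finally show ?thesis .
    qed
    have "R \<le> 2 * real (d + 1) * Q + sqrt ((1 + 2 * Q) * (real (d + 1) + 2 * (real (d + 1))\<^sup>2 * Q))"
      unfolding Rx by (rule sum_abs_U_le[OF triangle_free m[OF x] x Q])
    also have "\<dots> \<le> (3 * R + 1) / 20 + sqrt (3 / 2 * (2 * e ^ 3 + e ^ 2 * (3 * R + 1) / 10))"
      using dQ ddQ m2 Q1 Q0 by (intro add_mono real_sqrt_le_mono mult_mono) auto
    also have "(3 * R + 1) / 20 \<le> 4 / 25 * R"
      using R6' by (simp add: field_simps)
    finally have "21 / 25 * R \<le> sqrt (3 / 2 * (2 * e ^ 3 + e ^ 2 * (3 * R + 1) / 10))"
      by (simp add: algebra_simps)
    then have "(21 / 25 * R)\<^sup>2 \<le> (sqrt (3 / 2 * (2 * e ^ 3 + e ^ 2 * (3 * R + 1) / 10)))\<^sup>2"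
      using R0 by (intro power_mono) auto
    also have "\<dots> = 3 / 2 * (2 * e ^ 3 + e ^ 2 * (3 * R + 1) / 10)"
      using R0 e(1) by (intro real_sqrt_pow2) auto
    \<comment> \<open>The left side is about \<open>0.71 * R ^ 2\<close>. Under
      \<open>R > 6 * e ^ 2\<close> the right side is at most about
      \<open>0.17 * R ^ 2\<close>.\<close>
    finally have "(21 / 25 * R)\<^sup>2 \<le> 3 * e ^ 3 + 3 / 20 * (e ^ 2 * (3 * R + 1))" by simp
    moreover have "e ^ 3 \<le> R\<^sup>2 / 36"
    proof -
      have "(6 * e\<^sup>2)\<^sup>2 \<le> R\<^sup>2" using R_gt by (intro power_mono) auto
      then show ?thesis using e_powers by (simp add: power_mult_distrib flip: power_mult)
    qed
    moreover have "e ^ 2 * (3 * R + 1) \<le> (R / 6) * (19 / 6 * R)"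
      using R_gt R6' by (intro mult_mono) auto
    moreover have "R\<^sup>2 > 0" using R6' by simp
    ultimately show False by (simp add: power2_eq_square)
  qed
  define c where "c = (3 * R + 1) / 2"
  have c: "c \<le> 10 * e\<^sup>2" "c \<ge> 0" using R_le R0 e_powers by (auto simp: c_def)
  have "tr3 \<le> n + R + 9 * n * R + 5 * R * c + 3 * R\<^sup>2 * c + 2 * R * c\<^sup>2"
    unfolding c_def using R triangle_free U3 by (rule tr3_le)
  also have "\<dots> \<le> n + 6 * e\<^sup>2 + 9 * n * (6 * e\<^sup>2) + 5 * (6 * e\<^sup>2) * (10 * e\<^sup>2)
      + 3 * (6 * e\<^sup>2)\<^sup>2 * (10 * e\<^sup>2) + 2 * (6 * e\<^sup>2) * (10 * e\<^sup>2)\<^sup>2"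
    using c R_le R0 by (intro add_mono mult_mono power_mono) auto
  also have "\<dots> = n * 1 + 6 * e ^ 2 + 54 * (n * e ^ 2) + 300 * e ^ 4 + 2280 * e ^ 6"
    by (simp add: power_mult_distrib algebra_simps flip: power_add power_mult)
  also have "\<dots> \<le> n * e ^ 2 + 6 * e ^ 6 + 54 * (n * e ^ 2) + 300 * e ^ 6 + 2280 * e ^ 6"
    using e_powers by (intro add_mono mult_left_mono) auto
  \<comment> \<open>The \<open>e ^ 6\<close> coefficients add up to 2586, and \<open>e ^ 6\<close>
    is at most \<open>n * e ^ 2 / 40\<close>; 2586/40 is below 65.\<close>
  also have "\<dots> \<le> 55 * (n * e ^ 2) + 65 * (n * e ^ 2)"
  proof -
    have "(40 * e ^ 4) * e ^ 2 \<le> n * e ^ 2" using n by (intro mult_right_mono) auto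
    then have "40 * e ^ 6 \<le> n * e ^ 2" by (simp add: mult.assoc flip: power_add)
    moreover have "e ^ 6 \<ge> 0" using e(1) by simp
    ultimately show ?thesis by linarith
  qed
  finally have T3: "tr3 \<le> 120 * (n * e ^ 2)" by simp
  have t: "n / 2 \<le> tr1"
    using tr1_eq abs_sum_r_div_le[OF R] R_le n e_powers(5,6) by linarith
  then have "(n / 2) ^ 3 \<le> tr1 ^ 3" using n_pos by (intro power_mono) auto
  also have "\<dots> \<le> (real d)\<^sup>2 * tr3" using t n_pos by (intro tr1_cube_le) linarith
  also have "\<dots> \<le> (real d)\<^sup>2 * (120 * (n * e ^ 2))" using T3 by (intro mult_left_mono) auto
  also have "\<dots> = n * (120 * e ^ 8)"
    by (simp flip: e(2) power_mult power_add)
  finally have "n * n\<^sup>2 \<le> n * (960 * e ^ 8)"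
    by (simp add: power_divide power2_eq_square power3_eq_cube)
  then have "n\<^sup>2 \<le> 960 * e ^ 8" using n_pos by simp
  moreover have "(40 * e ^ 4)\<^sup>2 \<le> n\<^sup>2" using n e(1) by (intro power_mono) auto
  then have "1600 * e ^ 8 \<le> n\<^sup>2" by (simp add: power_mult_distrib flip: power_mult)
  moreover have "e ^ 8 > 0" using e(1) by simp
  ultimately show False by linarith
qed

end

section \<open>Transfer to almost-equidistant sets\<close>

lemma euclidean_dist_sq: "(euclidean_dist d x y)\<^sup>2 = (\<Sum>i<d. (x i - y i)\<^sup>2)"
  by (simp add: euclidean_dist_def L2_set_def sum_nonneg)

lemma euclidean_dist_nonneg: "euclidean_dist d x y \<ge> 0"
  by (simp add: euclidean_dist_def)

lemma euclidean_dist_commute: "euclidean_dist d x y = euclidean_dist d y x"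
  by (simp add: euclidean_dist_def L2_set_def power2_commute)

lemma euclidean_dist_triangle:
  "euclidean_dist d x z \<le> euclidean_dist d x y + euclidean_dist d y z"
  using L2_set_triangle_ineq[of "\<lambda>i. x i - y i" "\<lambda>i. y i - z i" "{..<d}"]
  by (simp add: euclidean_dist_def)

definition translate_to_centroid :: "(nat \<Rightarrow> real) set \<Rightarrow> (nat \<Rightarrow> real) \<Rightarrow> nat \<Rightarrow> real" where
  "translate_to_centroid V x i = x i - (\<Sum>y\<in>V. y i) / card V"

lemma centered_config_translate_to_centroid:
  assumes "finite V" "V \<noteq> {}"
  shows "centered_config V d (translate_to_centroid V)"
  using assms by unfold_locales (auto simp: translate_to_centroid_def sum_subtractf)

lemma U_translate_to_centroid:
  assumes "finite V" "V \<noteq> {}"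
  shows "centered_config.U d (translate_to_centroid V) x y = (if x = y then 0 else (euclidean_dist d x y)\<^sup>2 - 1)"
  using centered_config.U_def[OF centered_config_translate_to_centroid[OF assms]]
  by (simp add: euclidean_dist_sq translate_to_centroid_def)

text \<open>The clique bound is applied with \<open>S\<close> centred at its own centroid.\<close>

lemma unit_simplex_card:
  assumes "finite S" "\<And>x y. x \<in> S \<Longrightarrow> y \<in> S \<Longrightarrow> x \<noteq> y \<Longrightarrow> euclidean_dist d x y = 1"
  shows "card S \<le> d + 1"
proof (cases "S = {}")
  case False
  interpret centered_config S d "translate_to_centroid S"
    by (rule centered_config_translate_to_centroid[OF assms(1) False])
  show ?thesis
    by (rule clique_card) (simp add: U_translate_to_centroid[OF assms(1) False] assms(2))
qed simp

lemma almost_equidistantD: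
  assumes "almost_equidistant d V" "x \<in> V" "y \<in> V" "z \<in> V" "x \<noteq> y" "x \<noteq> z" "y \<noteq> z"
  shows "euclidean_dist d x y = 1 \<or> euclidean_dist d x z = 1 \<or> euclidean_dist d y z = 1"
  using assms unfolding almost_equidistant_def by blast

lemma almost_equidistant_subset:
  "almost_equidistant d V \<Longrightarrow> W \<subseteq> V \<Longrightarrow> almost_equidistant d W"
  unfolding almost_equidistant_def by (meson subset_iff)

text \<open>Two such points together with \<open>x\<close> form a triple whose only possible unit
  distance is the one between them, so these points form a unit simplex.\<close>

lemma card_non_neighbours:
  assumes "almost_equidistant d V" "finite V" "x \<in> V"
  shows "card {y\<in>V. y \<noteq> x \<and> euclidean_dist d x y \<noteq> 1} \<le> d + 1"
  using assms(2) almost_equidistantD[OF assms(1,3)] by (intro unit_simplex_card) auto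

text \<open>Each of \<open>x\<close> and \<open>y\<close> excludes at most \<open>d + 2\<close>
  points, itself included, so some \<open>w\<close> is at distance 1 from both. This is what bounds
  the entries of \<open>U\<close> by 3.\<close>

lemma almost_equidistant_dist_le_2:
  assumes V: "almost_equidistant d V" "finite V" "card V > 2 * d + 4" and xy: "x \<in> V" "y \<in> V"
  shows "euclidean_dist d x y \<le> 2"
proof -
  define N where "N x = {y\<in>V. y \<noteq> x \<and> euclidean_dist d x y \<noteq> 1}" for x
  have N: "card (insert x (N x)) \<le> d + 2" if "x \<in> V" for x
    using card_insert_le_m1[of "d + 2" "N x" x] card_non_neighbours[OF V(1,2) that] by (simp add: N_def)
  have "card (insert x (N x) \<union> insert y (N y)) \<le> card (insert x (N x)) + card (insert y (N y))"
    by (rule card_Un_le)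
  also have "\<dots> < card V" using N[OF xy(1)] N[OF xy(2)] V(3) by linarith
  finally have "\<not> V \<subseteq> insert x (N x) \<union> insert y (N y)"
    using V(2) xy by (auto simp: N_def dest: card_mono[rotated])
  then obtain w where "w \<in> V" "w \<notin> insert x (N x)" "w \<notin> insert y (N y)" by blast
  then have "euclidean_dist d x w = 1" "euclidean_dist d w y = 1"
    by (auto simp: N_def euclidean_dist_commute)
  then show ?thesis using euclidean_dist_triangle[of d x y w] by simp
qed

lemma almost_equidistant_finite_card:
  assumes V: "almost_equidistant d V" "finite V" and d: "d \<ge> 1"
  shows "card V \<le> 40 * real d powr (4 / 3)"
proof (rule ccontr)
  assume "\<not> ?thesis"
  then have gt: "card V > 40 * real d powr (4 / 3)" by simp
  define e where "e = real d powr (1 / 3)"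
  have e: "e \<ge> 1" "e ^ 3 = real d" "e ^ 4 = real d powr (4 / 3)"
    using d by (auto simp: e_def ge_one_powr_ge_zero powr_power)
  have "real d \<le> e ^ 4" using e power_increasing[of 3 4 e] by simp
  \<comment> \<open>\<open>40 * e ^ 4\<close> is at least \<open>40 * d\<close>, which exceeds
    \<open>2 * d + 4\<close> for \<open>d >= 1\<close>.\<close>
  then have big: "card V > 2 * d + 4" using gt e(3) d by linarith
  then have ne: "V \<noteq> {}" by auto
  interpret centered_config V d "translate_to_centroid V"
    by (rule centered_config_translate_to_centroid[OF V(2) ne])
  have U: "U x y = (if x = y then 0 else (euclidean_dist d x y)\<^sup>2 - 1)" for x y
    by (rule U_translate_to_centroid[OF V(2) ne])
  have U0: "U x y = 0 \<longleftrightarrow> x = y \<or> euclidean_dist d x y = 1" for x y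
    using euclidean_dist_nonneg[of d x y] by (auto simp: U power2_eq_1_iff)
  have "real (card V) < 40 * e ^ 4"
  proof (rule card_lt)
    fix x y z assume "x \<in> V" "y \<in> V" "z \<in> V"
    then show "U x y * U x z * U y z = 0"
      using almost_equidistantD[OF V(1)] by (auto simp: U0)
  next
    fix x y assume "x \<in> V" "y \<in> V"
    then have "(euclidean_dist d x y)\<^sup>2 \<le> 2\<^sup>2"
      using almost_equidistant_dist_le_2[OF V big] euclidean_dist_nonneg by (intro power_mono) auto
    moreover have "\<bar>a - 1\<bar> \<le> 3" if "a \<le> 2\<^sup>2" "0 \<le> a" for a :: real
      using that by (simp add: abs_le_iff)
    ultimately have "\<bar>(euclidean_dist d x y)\<^sup>2 - 1\<bar> \<le> 3" by simp
    then show "\<bar>U x y\<bar> \<le> 3" by (simp add: U)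
  next
    fix x assume x: "x \<in> V"
    have "{y\<in>V. U x y \<noteq> 0} = {y\<in>V. y \<noteq> x \<and> euclidean_dist d x y \<noteq> 1}"
      by (auto simp: U0)
    then show "card {y\<in>V. U x y \<noteq> 0} \<le> d + 1"
      using card_non_neighbours[OF V x] by simp
  qed (use e in auto)
  then show False using gt e(3) by simp
qed

theorem theorem1:
  shows "\<exists>K::real. K > 0 \<and>
    (\<forall>d\<ge>1. \<forall>V. almost_equidistant d V \<longrightarrow>
       finite V \<and> real (card V) \<le> K * real d powr (4 / 3))"
proof (intro exI[of _ 40] conjI allI impI)
  fix d :: nat and V assume d: "d \<ge> 1" and V: "almost_equidistant d V"
  show "finite V"
  proof (rule ccontr)
    assume "infinite V"
    \<comment> \<open>An infinite set would contain a finite subset just above the bound; the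
      ceiling and \<open>Suc\<close> make the excess strict.\<close>
    then obtain W where W: "W \<subseteq> V" "finite W" "card W = Suc (nat \<lceil>40 * real d powr (4 / 3)\<rceil>)"
      using infinite_arbitrarily_large by metis
    then show False
      using almost_equidistant_finite_card[OF almost_equidistant_subset[OF V W(1)] W(2) d]
      by linarith
  qed
  then show "real (card V) \<le> 40 * real d powr (4 / 3)"
    by (rule almost_equidistant_finite_card[OF V _ d])
qed simp

end
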